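(* Let $n\ge1$ and let $\Gamma$, $T$, final orbits and $K$ be as in the context. Let $p\in\Gamma$ and let $\mathbf{a}$ be the final orbit of $p$, regarded as a $2$-adic integer. Then there exists a smallest integer $s\ge1$ such that $\mathbf{a}+s$ is a final orbit (of some point of $\Gamma$), and the final orbit of $Kp$ is $\mathbf{a}+s$.
   Context: $\Gamma=\{(\alpha_1,\ldots,\alpha_n)\in\mathbb{R}^n:0\le\alpha_n\le\cdots\le\alpha_1\le1\}$. The tent map $T:\Gamma\to\Gamma$ is $T(\alpha_1,\ldots,\alpha_n)=(\alpha_1+\alpha_n,\alpha_1-\alpha_n,\alpha_2-\alpha_n,\ldots,\alpha_{n-1}-\alpha_n)$ if $\alpha_1+\alpha_n\le1$, and $(2-\alpha_1-\alpha_n,\alpha_1-\alpha_n,\ldots,\alpha_{n-1}-\alpha_n)$ if $\alpha_1+\alpha_n\ge1$. Its restrictions to $\Gamma\cap\{\alpha_1+\alpha_n\le1\}$ and $\Gamma\cap\{\alpha_1+\alpha_n\ge1\}$ are affine bijections onto $\Gamma$, with inverses $\tau_0,\tau_1$; $\Gamma_a=\tau_a\Gamma$. $\Gamma^o=\{\alpha\in\Gamma:\alpha_1<1\}$, $v_0=(0,\ldots,0)$, $v_{-1}$ the unique fixed point of $\tau_1$ in $\Gamma$. The sets $\{v_{-1}\}$ and $\tau_1^k\tau_0\Gamma^o$ ($k\ge0$) partition $\Gamma$; the map $K:\Gamma\to\Gamma$ is defined by $Kv_{-1}=v_0$ and $K=\tau_0^k\tau_1\circ(\tau_1^k\tau_0)^{-1}$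 on $\tau_1^k\tau_0\Gamma^o$, where $\tau_1^k\tau_0:\Gamma^o\to\tau_1^k\tau_0\Gamma^o$ is a bijection. A sequence $\mathbf{a}=a_0a_1\ldots\in\{0,1\}^{\mathbb{N}}$ is a symbolic orbit of $p$ if $T^tp\in\Gamma_{a_t}$ for all $t\ge0$; the final orbit of $p$ is its unique symbolic orbit with $a_t=1$ whenever $T^tp\in\Gamma_0\cap\Gamma_1$; a sequence is a final orbit if it is the final orbit of some point. Sequences $a_0a_1\ldots$ are identified with $2$-adic integers $\sum_i a_i2^i$ (addition componentwise from left to right with carry; $1=10^\infty$). *)

theory Defs
  imports Complex_Main "HOL-Library.FuncSet"
begin

text \<open>
  Points of \<open>\<real>\<^sup>n\<close> are functions on the index set \<open>{1..n}\<close>, extensional (\<open>undefined\<close>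
  elsewhere), so that equality of points is equality of their \<open>n\<close> coordinates.
\<close>

definition Gam :: "nat \<Rightarrow> (nat \<Rightarrow> real) set" where
  "Gam n = {\<alpha> \<in> extensional {1..n}. 0 \<le> \<alpha> n \<and> (\<forall>i\<in>{1..<n}. \<alpha> (Suc i) \<le> \<alpha> i) \<and> \<alpha> 1 \<le> 1}"

definition tent :: "nat \<Rightarrow> (nat \<Rightarrow> real) \<Rightarrow> nat \<Rightarrow> real" where
  "tent n \<alpha> = (\<lambda>i\<in>{1..n}.
     if i = 1 then (if \<alpha> 1 + \<alpha> n \<le> 1 then \<alpha> 1 + \<alpha> n else 2 - \<alpha> 1 - \<alpha> n)
     else \<alpha> (i - 1) - \<alpha> n)"

text \<open>Digits are the natural numbers \<open>0\<close> and \<open>1\<close>; other values of \<open>a\<close> never matter below.\<close>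

definition tent_dom :: "nat \<Rightarrow> nat \<Rightarrow> (nat \<Rightarrow> real) set" where
  "tent_dom n a = {\<alpha> \<in> Gam n. if a = 0 then \<alpha> 1 + \<alpha> n \<le> 1 else \<alpha> 1 + \<alpha> n \<ge> 1}"

definition tau :: "nat \<Rightarrow> nat \<Rightarrow> (nat \<Rightarrow> real) \<Rightarrow> (nat \<Rightarrow> real)" where
  "tau n a = the_inv_into (tent_dom n a) (tent n)"

definition Gam_digit :: "nat \<Rightarrow> nat \<Rightarrow> (nat \<Rightarrow> real) set" where
  "Gam_digit n a = tau n a ` Gam n"

definition Gam_o :: "nat \<Rightarrow> (nat \<Rightarrow> real) set" where
  "Gam_o n = {\<alpha> \<in> Gam n. \<alpha> 1 < 1}"

definition v_zero :: "nat \<Rightarrow> nat \<Rightarrow> real" where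
  "v_zero n = (\<lambda>i\<in>{1..n}. 0)"

definition v_minus_one :: "nat \<Rightarrow> nat \<Rightarrow> real" where
  "v_minus_one n = (THE v. v \<in> Gam n \<and> tau n 1 v = v)"

text \<open>The map \<open>\<tau>\<^sub>1\<^sup>k \<circ> \<tau>\<^sub>0\<close>; the images of \<open>\<Gamma>\<^sup>o\<close> under these maps and the fixed point of
  \<open>\<tau>\<^sub>1\<close> partition \<open>\<Gamma>\<close>, so the \<open>THE k\<close> below is the index of the piece containing \<open>p\<close>.\<close>

definition tau_1k0 :: "nat \<Rightarrow> nat \<Rightarrow> (nat \<Rightarrow> real) \<Rightarrow> (nat \<Rightarrow> real)" where
  "tau_1k0 n k = (tau n 1 ^^ k) \<circ> tau n 0"

definition K_map :: "nat \<Rightarrow> (nat \<Rightarrow> real) \<Rightarrow> (nat \<Rightarrow> real)" where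
  "K_map n p =
     (if p = v_minus_one n then v_zero n
      else let k = (THE k. p \<in> tau_1k0 n k ` Gam_o n)
           in (tau n 0 ^^ k) (tau n 1 (the_inv_into (Gam_o n) (tau_1k0 n k) p)))"

definition symbolic_orbit :: "nat \<Rightarrow> (nat \<Rightarrow> real) \<Rightarrow> (nat \<Rightarrow> nat) \<Rightarrow> bool" where
  "symbolic_orbit n p a \<longleftrightarrow>
     (\<forall>t. a t \<in> {0, 1}) \<and> (\<forall>t. (tent n ^^ t) p \<in> Gam_digit n (a t))"

definition final_orbit_of :: "nat \<Rightarrow> (nat \<Rightarrow> real) \<Rightarrow> (nat \<Rightarrow> nat) \<Rightarrow> bool" where
  "final_orbit_of n p a \<longleftrightarrow> symbolic_orbit n p a \<and>
     (\<forall>t. (tent n ^^ t) p \<in> Gam_digit n 0 \<inter> Gam_digit n 1 \<longrightarrow> a t = 1)"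

definition is_final_orbit :: "nat \<Rightarrow> (nat \<Rightarrow> nat) \<Rightarrow> bool" where
  "is_final_orbit n a \<longleftrightarrow> (\<exists>p\<in>Gam n. final_orbit_of n p a)"

text \<open>A 2-adic integer is its sequence of binary digits, least significant digit first.\<close>

primrec carry :: "(nat \<Rightarrow> nat) \<Rightarrow> (nat \<Rightarrow> nat) \<Rightarrow> nat \<Rightarrow> nat" where
  "carry a b 0 = 0"
| "carry a b (Suc i) = (a i + b i + carry a b i) div 2"

definition adic_add :: "(nat \<Rightarrow> nat) \<Rightarrow> (nat \<Rightarrow> nat) \<Rightarrow> nat \<Rightarrow> nat" where
  "adic_add a b i = (a i + b i + carry a b i) mod 2"

definition adic_of_nat :: "nat \<Rightarrow> nat \<Rightarrow> nat" where
  "adic_of_nat s i = s div 2 ^ i mod 2"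

text \<open>The following facts justify the definitions of \<open>tau\<close> and of the final orbit.\<close>

lemma Gam_iff:
  assumes "n \<ge> 1"
  shows "\<alpha> \<in> Gam n \<longleftrightarrow> \<alpha> \<in> extensional {1..n} \<and> (\<forall>i\<in>{1..n}. 0 \<le> \<alpha> i \<and> \<alpha> i \<le> 1) \<and>
           (\<forall>i\<in>{1..n}. \<forall>j\<in>{1..n}. i \<le> j \<longrightarrow> \<alpha> j \<le> \<alpha> i)"
proof
  assume \<alpha>: "\<alpha> \<in> Gam n"
  have mono: "\<alpha> j \<le> \<alpha> i" if "1 \<le> i" "i \<le> j" "j \<le> n" for i j
    using that(2,3)
  proof (induction j rule: dec_induct)
    case (step m)
    then have "\<alpha> (Suc m) \<le> \<alpha> m" using \<alpha> that(1) by (auto simp: Gam_def)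
    then show ?case using step by simp
  qed simp
  have "0 \<le> \<alpha> i \<and> \<alpha> i \<le> 1" if "i \<in> {1..n}" for i
    using mono[of 1 i] mono[of i n] that \<alpha> by (auto simp: Gam_def)
  then show "\<alpha> \<in> extensional {1..n} \<and> (\<forall>i\<in>{1..n}. 0 \<le> \<alpha> i \<and> \<alpha> i \<le> 1) \<and>
           (\<forall>i\<in>{1..n}. \<forall>j\<in>{1..n}. i \<le> j \<longrightarrow> \<alpha> j \<le> \<alpha> i)"
    using mono \<alpha> by (auto simp: Gam_def)
qed (use assms in \<open>auto simp: Gam_def\<close>)

lemma tent_in_Gam:
  assumes n: "n \<ge> 1" and \<alpha>: "\<alpha> \<in> Gam n"
  shows "tent n \<alpha> \<in> Gam n"
proof -
  have b: "0 \<le> \<alpha> i" "\<alpha> i \<le> 1" if "1 \<le> i" "i \<le> n" for i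
    using \<alpha> that unfolding Gam_iff[OF n] by auto
  have m: "\<alpha> j \<le> \<alpha> i" if "1 \<le> i" "i \<le> j" "j \<le> n" for i j
    using \<alpha> that unfolding Gam_iff[OF n] by auto
  have "0 \<le> tent n \<alpha> n" using b[of 1] b[of n] m[of "n - 1" n] n
    by (auto simp: tent_def)
  moreover have "tent n \<alpha> (Suc i) \<le> tent n \<alpha> i" if "i \<in> {1..<n}" for i
    using b[of 1] b[of n] m[of "i - 1" i] that n by (auto simp: tent_def)
  moreover have "tent n \<alpha> 1 \<le> 1" using n by (auto simp: tent_def)
  ultimately show ?thesis by (auto simp: Gam_def tent_def)
qed

lemma bij_betw_tent:
  assumes n: "n \<ge> 1"
  shows "bij_betw (tent n) (tent_dom n a) (Gam n)"
proof (rule bij_betw_imageI)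
  show "inj_on (tent n) (tent_dom n a)"
  proof (rule inj_onI)
    fix x y assume x: "x \<in> tent_dom n a" and y: "y \<in> tent_dom n a" and e: "tent n x = tent n y"
    have e1: "x 1 + x n = y 1 + y n"
      using fun_cong[OF e, of 1] x y n by (auto simp: tent_def tent_dom_def split: if_splits)
    have e2: "x i - x n = y i - y n" if "i \<in> {1..<n}" for i
      using fun_cong[OF e, of "Suc i"] that by (auto simp: tent_def split: if_splits)
    have e3: "x n = y n"
      using e1 e2[of 1] n by (cases "n = 1") auto
    have "x i = y i" if "i \<in> {1..n}" for i
      using e2[of i] e3 that by (cases "i = n") auto
    moreover have "x \<in> extensional {1..n}" "y \<in> extensional {1..n}"
      using x y by (auto simp: tent_dom_def Gam_def)
    ultimately show "x = y" by (metis extensionalityI)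
  qed
  show "tent n ` tent_dom n a = Gam n"
  proof
    show "tent n ` tent_dom n a \<subseteq> Gam n"
      using tent_in_Gam[OF n] by (auto simp: tent_dom_def)
    show "Gam n \<subseteq> tent n ` tent_dom n a"
    proof
      fix \<beta> assume \<beta>: "\<beta> \<in> Gam n"
      define B where "B i = (if i \<le> n then \<beta> i else 0)" for i
      define S where "S = (if a = 0 then \<beta> 1 else 2 - \<beta> 1)"
      define c where "c = (S - B 2) / 2"
      define \<alpha> where "\<alpha> = (\<lambda>i\<in>{1..n}. B (Suc i) + c)"
      have b: "0 \<le> \<beta> i" "\<beta> i \<le> 1" if "1 \<le> i" "i \<le> n" for i
        using \<beta> that unfolding Gam_iff[OF n] by auto
      have m: "\<beta> j \<le> \<beta> i" if "1 \<le> i" "i \<le> j" "j \<le> n" for i j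
        using \<beta> that unfolding Gam_iff[OF n] by auto
      have Bm: "B (Suc i) \<le> B i" if "1 \<le> i" for i
        using m[of i "Suc i"] b[of i] that by (auto simp: B_def)
      have S: "\<beta> 1 \<le> S" "S \<le> 2 - \<beta> 1" using b[of 1] n by (auto simp: S_def)
      have B1: "B 1 = \<beta> 1" using n by (simp add: B_def)
      have B2: "B 2 \<le> \<beta> 1" "0 \<le> B 2" using Bm[of 1] B1 b[of 2] by (auto simp: B_def numeral_2_eq_2)
      have \<alpha>n: "\<alpha> n = c" using n by (simp add: \<alpha>_def B_def)
      have \<alpha>1: "\<alpha> 1 = (S + B 2) / 2" using n by (simp add: \<alpha>_def c_def numeral_2_eq_2 field_simps)
      have sum: "\<alpha> 1 + \<alpha> n = S" using \<alpha>1 \<alpha>n by (simp add: c_def field_simps)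
      have "\<alpha> \<in> Gam n"
        using \<alpha>1 \<alpha>n S B2 Bm by (auto simp: Gam_def) (auto simp: \<alpha>_def c_def field_simps)
      then have "\<alpha> \<in> tent_dom n a"
        using sum b[of 1] n by (auto simp: tent_dom_def S_def)
      moreover have "tent n \<alpha> = \<beta>"
      proof (rule extensionalityI)
        show "tent n \<alpha> \<in> extensional {1..n}" by (simp add: tent_def)
        show "\<beta> \<in> extensional {1..n}" using \<beta> by (simp add: Gam_def)
        fix i assume i: "i \<in> {1..n}"
        show "tent n \<alpha> i = \<beta> i"
        proof (cases "i = 1")
          case True
          have "tent n \<alpha> 1 = (if S \<le> 1 then S else 2 - S)"
            using sum n by (simp add: tent_def) 
          then show ?thesis using True b[of 1] n by (auto simp: S_def)
        next
          case False
          then have "\<alpha> (i - 1) = \<beta> i + c" using i by (auto simp: \<alpha>_def B_def)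
          then show ?thesis using False i \<alpha>n by (simp add: tent_def)
        qed
      qed
      ultimately show "\<beta> \<in> tent n ` tent_dom n a" by blast
    qed
  qed
qed

lemma Gam_digit_eq:
  assumes "n \<ge> 1"
  shows "Gam_digit n a = tent_dom n a"
  using bij_betw_the_inv_into[OF bij_betw_tent[OF assms, of a]]
  by (simp add: Gam_digit_def tau_def bij_betw_def)

lemma ex1_final_orbit_of:
  assumes n: "n \<ge> 1" and p: "p \<in> Gam n"
  shows "\<exists>!a. final_orbit_of n p a"
proof -
  have G: "(tent n ^^ t) p \<in> Gam n" for t
    by (induction t) (use p tent_in_Gam[OF n] in auto)
  define a :: "nat \<Rightarrow> nat" where "a t = (if (tent n ^^ t) p \<in> tent_dom n 1 then 1 else 0)" for t
  have cov: "x \<in> tent_dom n 0 \<or> x \<in> tent_dom n 1" if "x \<in> Gam n" for x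
    using that by (auto simp: tent_dom_def)
  show ?thesis
  proof (rule ex1I[of _ a])
    show "final_orbit_of n p a"
      using cov[OF G] by (auto simp: final_orbit_of_def symbolic_orbit_def Gam_digit_eq[OF n] a_def)
    fix b assume b: "final_orbit_of n p b"
    show "b = a"
    proof
      fix t
      have "b t \<in> {0, 1}" "(tent n ^^ t) p \<in> tent_dom n (b t)"
        "(tent n ^^ t) p \<in> tent_dom n 0 \<inter> tent_dom n 1 \<longrightarrow> b t = 1"
        using b unfolding final_orbit_of_def symbolic_orbit_def Gam_digit_eq[OF n] by blast+
      then show "b t = a t" by (auto simp: a_def)
    qed
  qed
qed

end

theory Submission
  imports Defs
begin

text \<open>
  A point is determined by any of its symbolic orbits, because the simplices
  \<open>\<tau>\<^bsub>a\<^sub>0\<^esub> \<dots> \<tau>\<^bsub>a\<^sub>t\<^esub> \<Gamma>\<close>, obtained by repeated bisection, shrink to a point.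

  Let \<open>p = \<tau>\<^sub>1\<^sup>k \<tau>\<^sub>0 q\<close> with \<open>q \<in> \<Gamma>\<^sup>o\<close>, so \<open>a = 1\<^sup>k 0 b\<close> with \<open>b\<close> the final orbit of \<open>q\<close>, and
  \<open>K p = \<tau>\<^sub>0\<^sup>k \<tau>\<^sub>1 q\<close>. The final digit of a point of \<open>\<tau>\<^sub>0 \<Gamma>\<close> is \<open>1\<close> iff the first coordinate of its image
  under \<open>T\<close> is \<open>1\<close>, and if \<open>\<tau>\<^sub>0 x\<close> has first coordinate \<open>1\<close> then so does \<open>x\<close>. Hence
  the \<open>i < k\<close> for which \<open>\<tau>\<^sub>0\<^sup>i \<tau>\<^sub>1 q\<close> has first coordinate \<open>1\<close> are those below some \<open>L \<le> k\<close>, and the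
  final orbit of \<open>K p\<close> is \<open>0\<^sup>k\<^sup>-\<^sup>L 1\<^sup>L\<^sup>+\<^sup>1 b\<close>. On the other hand, \<open>\<tau>\<^sub>0 = \<tau>\<^sub>1\<close> on points with first
  coordinate \<open>1\<close>, so every final orbit \<open>c b\<close> with \<open>|c| = k + 1\<close> and \<open>c\<^sub>k = 1\<close> ends its block \<open>c\<close> in
  \<open>1\<^sup>L\<^sup>+\<^sup>1\<close>, and \<open>0\<^sup>k\<^sup>-\<^sup>L 1\<^sup>L\<^sup>+\<^sup>1\<close> is the least such block.
\<close>

section \<open>Contraction of the nested simplices\<close>

text \<open>
  Bisecting a simplex with vertices \<open>x\<^sub>0, x\<^sub>1, \<dots>, x\<^sub>n\<close> gives the simplices \<open>h, m, x\<^sub>1, \<dots>, x\<^sub>n\<^sub>-\<^sub>1\<close> with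
  \<open>h \<in> {x\<^sub>0, x\<^sub>n}\<close> and \<open>m\<close> the midpoint of \<open>x\<^sub>0\<close> and \<open>x\<^sub>n\<close>. Below, \<open>H\<close> and \<open>Z\<close> are the values of an
  affine function at the hubs \<open>h\<close> and at the vertices queued behind it.
\<close>

locale hub_queue =
  fixes n :: nat and H Z :: "nat \<Rightarrow> real"
  assumes n_pos: "n \<ge> 1"
    and Z_add: "Z (t + n) = (H t + Z t) / 2"
    and H_Suc: "H (Suc t) \<in> {H t, Z t}"
begin

definition state :: "nat \<Rightarrow> real set" where
  "state t = insert (H t) (Z ` {t..<t + n})"

lemma H_add: "H (s + j) \<in> insert (H s) (Z ` {s..<s + j})"
proof (induction j)
  case (Suc j)
  then show ?case using H_Suc[of "s + j"] by auto
qed simp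

text \<open>Each later hub or queued point is an earlier one or a midpoint of two earlier ones, so
  intervals, being convex, trap them all.\<close>

lemma state_subset_later:
  assumes "state t \<subseteq> {m..M}" "s \<ge> t"
  shows "H s \<in> {m..M} \<and> Z s \<in> {m..M}"
  using assms(2)
proof (induction s rule: less_induct)
  case (less s)
  have H: "H s \<in> {m..M}"
  proof (cases "s = t")
    case True
    then show ?thesis using assms(1) by (simp add: state_def)
  next
    case False
    then obtain r where "s = Suc r" "r \<ge> t" using less.prems by (cases s) auto
    then show ?thesis using H_Suc[of r] less.IH[of r] by auto
  qed
  have "Z s \<in> {m..M}"
  proof (cases "s < t + n")
    case True
    then have "Z s \<in> state t" using less.prems by (auto simp: state_def)
    then show ?thesis using assms(1) by auto
  next
    case False
    define r where "r = s - n"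
    have r: "s = r + n" "r \<ge> t" "r < s" using False n_pos by (auto simp: r_def)
    then show ?thesis using less.IH[of r] Z_add[of r] by auto
  qed
  with H show ?case by simp
qed

lemma state_diam_later:
  assumes "\<And>x y. x \<in> state t \<Longrightarrow> y \<in> state t \<Longrightarrow> \<bar>x - y\<bar> \<le> R"
  obtains m where "\<And>s. s \<ge> t \<Longrightarrow> H s \<in> {m..m + R} \<and> Z s \<in> {m..m + R}"
proof -
  have fin: "finite (state t)" "state t \<noteq> {}" by (auto simp: state_def)
  have "state t \<subseteq> {Min (state t)..Min (state t) + R}"
    using assms[OF _ Min_in[OF fin]] fin Min_le[OF fin(1)] by (force simp: abs_le_iff)
  then show thesis using that state_subset_later by blast
qed

text \<open>
  Two midpoints either share an endpoint, or the hub of the later one is a queued point created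
  close to an endpoint of the earlier one; so every pass through the queue widens the window.
\<close>

lemma window_contraction:
  assumes diam: "\<And>x y. x \<in> state t \<Longrightarrow> y \<in> state t \<Longrightarrow> \<bar>x - y\<bar> \<le> R"
  shows "s \<ge> t + k * n \<Longrightarrow> j \<le> k \<Longrightarrow> \<bar>Z s - Z (s + j)\<bar> \<le> (1 - (1/2) ^ k) * R"
proof -
  obtain m where m: "\<And>s. s \<ge> t \<Longrightarrow> H s \<in> {m..m + R} \<and> Z s \<in> {m..m + R}"
    using state_diam_later[OF diam] by blast
  have R0: "R \<ge> 0" using diam[of "H t" "H t"] by (simp add: state_def)
  show "s \<ge> t + k * n \<Longrightarrow> j \<le> k \<Longrightarrow> \<bar>Z s - Z (s + j)\<bar> \<le> (1 - (1/2) ^ k) * R"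
  proof (induction k arbitrary: s j)
    case 0
    then show ?case by simp
  next
    case (Suc k)
    \<comment> \<open>One queue pass earlier: \<open>Z s\<close> and \<open>Z (s + j)\<close> are
      the midpoints formed at times \<open>r\<close> and \<open>r + j\<close>.\<close>
    define r where "r = s - n"
    have r: "s = r + n" "r \<ge> t + k * n" using Suc.prems by (auto simp: r_def)
    then have rt: "r \<ge> t" by (meson add_leD1)
    define \<mu> where "\<mu> = (1 - (1/2) ^ k) * R"
    have \<mu>: "0 \<le> \<mu>" "(1 - (1/2) ^ Suc k) * R = (\<mu> + R) / 2"
      using R0 mult_left_mono[of 1 "2 ^ k" R] by (auto simp: \<mu>_def power_le_one field_simps)
    have e: "Z s - Z (s + j) = (H r + Z r - H (r + j) - Z (r + j)) / 2"
      using Z_add[of r] Z_add[of "r + j"] r(1) by (simp add: algebra_simps)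
    have "\<bar>H r + Z r - H (r + j) - Z (r + j)\<bar> \<le> \<mu> + R"
    proof (cases "H (r + j) = H r")
      case True
      then show ?thesis using m[OF rt] m[of "r + j"] rt \<mu>(1) by auto
    next
      case False
      then obtain i where i: "H (r + j) = Z (r + i)" "i < j"
        using H_add[of r j] by auto (metis le_Suc_ex nat_add_left_cancel_less)
      then have "\<bar>Z r - Z (r + i)\<bar> \<le> \<mu>"
        using Suc.IH[of r i] r(2) Suc.prems by (simp add: \<mu>_def)
      moreover have "\<bar>H r - Z (r + j)\<bar> \<le> R" using m[OF rt] m[of "r + j"] rt by auto
      ultimately show ?thesis using i(1) by linarith
    qed
    then show ?case unfolding e \<mu>(2) by auto
  qed
qed

text \<open>After \<open>n\<close> passes the windows span the whole queue. In one more pass every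
  queued point becomes a midpoint with an endpoint equal to the new hub or within a window of it, so
  its distance to that hub contracts too.\<close>

lemma state_contraction:
  assumes diam: "\<And>x y. x \<in> state t \<Longrightarrow> y \<in> state t \<Longrightarrow> \<bar>x - y\<bar> \<le> R"
    and x: "x \<in> state (t + Suc n * n)" and y: "y \<in> state (t + Suc n * n)"
  shows "\<bar>x - y\<bar> \<le> (1 - (1/2) ^ Suc n) * R"
proof -
  obtain m where m: "\<And>s. s \<ge> t \<Longrightarrow> H s \<in> {m..m + R} \<and> Z s \<in> {m..m + R}"
    using state_diam_later[OF diam] by blast
  have R0: "R \<ge> 0" using diam[of "H t" "H t"] by (simp add: state_def)
  define \<mu> where "\<mu> = (1 - (1/2) ^ n) * R"
  have \<mu>: "0 \<le> \<mu>" "\<mu> \<le> R" "(1 - (1/2) ^ Suc n) * R = (\<mu> + R) / 2"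
    using R0 mult_left_mono[of 1 "2 ^ n" R] by (auto simp: \<mu>_def power_le_one field_simps)
  let ?T = "t + Suc n * n"
  have win: "\<bar>Z s - Z (s + j)\<bar> \<le> \<mu>" if "s \<ge> t + n * n" "j \<le> n" for s j
    unfolding \<mu>_def using window_contraction[of t R n s j] diam that by blast
  have hub: "\<bar>Z (?T + j) - H ?T\<bar> \<le> (\<mu> + R) / 2" if "j < n" for j
  proof -
    define r where "r = t + n * n + j"
    define i where "i = n - j"
    have r: "?T + j = r + n" "?T = r + i" "r \<ge> t" "i \<le> n"
      using that by (auto simp: r_def i_def)
    have e: "Z (?T + j) = (H r + Z r) / 2" unfolding r(1) by (rule Z_add)
    have "\<bar>H r + Z r - 2 * H ?T\<bar> \<le> \<mu> + R"
    proof (cases "H ?T = H r")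
      case True
      then show ?thesis using m[OF r(3)] \<mu> by auto
    next
      case False
      then obtain l where l: "H ?T = Z (r + l)" "l < i"
        using H_add[of r i] unfolding r(2) by auto (metis le_Suc_ex nat_add_left_cancel_less)
      then have "\<bar>Z r - H ?T\<bar> \<le> \<mu>" using win[of r l] r by (simp add: r_def)
      moreover have "\<bar>H r - H ?T\<bar> \<le> R" using m[OF r(3)] m[of ?T] by auto
      ultimately show ?thesis by linarith
    qed
    then show ?thesis unfolding e by (simp add: abs_le_iff field_simps)
  qed
  have zz: "\<bar>Z (?T + i) - Z (?T + j)\<bar> \<le> (\<mu> + R) / 2" if "i < n" "j < n" for i j
  proof -
    have "\<bar>Z (?T + i) - Z (?T + j)\<bar> \<le> \<mu>"
    proof (cases "i \<le> j")
      case True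
      then have "?T + i + (j - i) = ?T + j" by simp
      moreover have "\<bar>Z (?T + i) - Z (?T + i + (j - i))\<bar> \<le> \<mu>"
        by (rule win) (use that in auto)
      ultimately show ?thesis by (simp only:)
    next
      case False
      then have "?T + j + (i - j) = ?T + i" by simp
      moreover have "\<bar>Z (?T + j) - Z (?T + j + (i - j))\<bar> \<le> \<mu>"
        by (rule win) (use that in auto)
      ultimately show ?thesis by (simp only: abs_minus_commute)
    qed
    then show ?thesis using \<mu> by simp
  qed
  have "v = H ?T \<or> (\<exists>j<n. v = Z (?T + j))" if "v \<in> state ?T" for v
    using that unfolding state_def by auto (metis le_Suc_ex nat_add_left_cancel_less)
  from this[OF x] this[OF y] show ?thesis
    unfolding \<mu>(3) using hub zz \<mu> R0 by (auto simp: abs_minus_commute)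
qed

lemma state_diam_tendsto_0:
  assumes "\<epsilon> > 0"
  obtains t where "\<And>x y. x \<in> state t \<Longrightarrow> y \<in> state t \<Longrightarrow> \<bar>x - y\<bar> \<le> \<epsilon>"
proof -
  define \<mu> :: real where "\<mu> = 1 - (1/2) ^ Suc n"
  have "(1/2 :: real) ^ Suc n \<le> 1" by (rule power_le_one) auto
  then have \<mu>: "0 \<le> \<mu>" "\<mu> < 1" by (auto simp: \<mu>_def)
  define R where "R = Max (state 0) - Min (state 0)"
  have fin: "finite (state 0)" "state 0 \<noteq> {}" by (auto simp: state_def)
  have base: "\<bar>x - y\<bar> \<le> R" if "x \<in> state 0" "y \<in> state 0" for x y
    using Min_le[OF fin(1) that(1)] Min_le[OF fin(1) that(2)]
      Max_ge[OF fin(1) that(1)] Max_ge[OF fin(1) that(2)] by (auto simp: R_def)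
  have iter: "\<bar>x - y\<bar> \<le> \<mu> ^ k * R"
    if "x \<in> state (k * (Suc n * n))" "y \<in> state (k * (Suc n * n))" for k x y
    using that
  proof (induction k arbitrary: x y)
    case 0
    then show ?case using base by simp
  next
    case (Suc k)
    have "Suc k * (Suc n * n) = k * (Suc n * n) + Suc n * n" by simp
    then have "\<bar>x - y\<bar> \<le> (1 - (1/2) ^ Suc n) * (\<mu> ^ k * R)"
      using state_contraction[OF Suc.IH] Suc.prems by metis
    then show ?case by (simp add: \<mu>_def)
  qed
  have "(\<lambda>k. \<mu> ^ k * R) \<longlonglongrightarrow> 0 * R"
    by (intro tendsto_mult tendsto_const LIMSEQ_realpow_zero \<mu>)
  then have "\<forall>\<^sub>F k in sequentially. \<mu> ^ k * R < \<epsilon>"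
    using assms by (intro order_tendstoD(2)) auto
  then obtain k where "\<mu> ^ k * R < \<epsilon>" by (auto simp: eventually_sequentially)
  then show thesis using that[of "k * (Suc n * n)"] iter by (meson less_imp_le order_trans)
qed

end


section \<open>A point is determined by its symbolic orbits\<close>

text \<open>The test on the right sends ties to 1, so it produces a final orbit; uniqueness of the
  final orbit does the rest.\<close>

lemma final_orbit_of_iff:
  assumes n: "n \<ge> 1" and p: "p \<in> Gam n"
  shows "final_orbit_of n p a \<longleftrightarrow>
    (\<forall>t. a t = (if (tent n ^^ t) p 1 + (tent n ^^ t) p n \<ge> 1 then 1 else 0))"
proof -
  have G: "(tent n ^^ t) p \<in> Gam n" for t
    by (induction t) (use p tent_in_Gam[OF n] in auto)
  have "final_orbit_of n p (\<lambda>t. if (tent n ^^ t) p 1 + (tent n ^^ t) p n \<ge> 1 then 1 else 0)"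
    using G by (auto simp: final_orbit_of_def symbolic_orbit_def Gam_digit_eq[OF n] tent_dom_def)
  then have "final_orbit_of n p a \<longleftrightarrow>
      a = (\<lambda>t. if (tent n ^^ t) p 1 + (tent n ^^ t) p n \<ge> 1 then 1 else 0)"
    using ex1_final_orbit_of[OF n p] by auto
  then show ?thesis by (simp add: fun_eq_iff)
qed

context
  fixes n :: nat
  assumes n: "n \<ge> 1"
begin

text \<open>With the convention that coordinate \<open>n + 1\<close> is 0, the differences of
  consecutive coordinates are the barycentric coordinates of the nonzero vertices of
  \<open>Gam n\<close>.\<close>

definition pad :: "(nat \<Rightarrow> real) \<Rightarrow> nat \<Rightarrow> real" where
  "pad \<alpha> i = (if i \<le> n then \<alpha> i else 0)"

text \<open>The value at \<open>\<alpha>\<close> of the affine function with value \<open>u i\<close> at the vertex \<open>e\<^sub>1 + \<dots> + e\<^sub>i\<close> of \<open>\<Gamma>\<close>.\<close>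

definition affine_val :: "(nat \<Rightarrow> real) \<Rightarrow> (nat \<Rightarrow> real) \<Rightarrow> real" where
  "affine_val u \<alpha> = u 0 * (1 - \<alpha> 1) + (\<Sum>i=1..n. u i * (pad \<alpha> i - pad \<alpha> (Suc i)))"

text \<open>Vertex values of the affine function composed with \<open>tau n d\<close>: this branch
  sends vertex 0 to vertex 0 or \<open>n\<close>, vertex 1 to their midpoint, and vertex
  \<open>i > 1\<close> to vertex \<open>i - 1\<close>.\<close>

definition bisect :: "nat \<Rightarrow> (nat \<Rightarrow> real) \<Rightarrow> nat \<Rightarrow> real" where
  "bisect d u i = (if i = 0 then (if d = 0 then u 0 else u n)
     else if i = 1 then (u 0 + u n) / 2 else u (i - 1))"

text \<open>The map \<open>tent\<close> shifts the differences of consecutive coordinates, so the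
  middle sums coincide and only the terms of the vertices 0 and 1, against 0 and \<open>n\<close>,
  need comparing.\<close>

lemma affine_val_bisect:
  assumes \<alpha>: "\<alpha> \<in> tent_dom n d"
  shows "affine_val (bisect d u) (tent n \<alpha>) = affine_val u \<alpha>"
proof -
  define \<beta> where "\<beta> = tent n \<alpha>"
  have b1: "\<beta> 1 = (if d = 0 then \<alpha> 1 + \<alpha> n else 2 - \<alpha> 1 - \<alpha> n)"
    using \<alpha> n by (auto simp: \<beta>_def tent_def tent_dom_def split: if_splits)
  have b: "pad \<beta> (Suc i) = \<alpha> i - \<alpha> n" if "1 \<le> i" "i \<le> n" for i
    using that by (cases "i = n") (auto simp: \<beta>_def tent_def pad_def)
  have "(\<Sum>i=1..n. bisect d u i * (pad \<beta> i - pad \<beta> (Suc i)))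
      = bisect d u 1 * (\<beta> 1 - pad \<beta> 2) + (\<Sum>i=Suc 1..n. bisect d u i * (pad \<beta> i - pad \<beta> (Suc i)))"
    using n by (simp add: sum.atLeast_Suc_atMost pad_def numeral_2_eq_2)
  also have "(\<Sum>i=Suc 1..n. bisect d u i * (pad \<beta> i - pad \<beta> (Suc i)))
      = (\<Sum>i=1..n-1. bisect d u (Suc i) * (pad \<beta> (Suc i) - pad \<beta> (Suc (Suc i))))"
    using n by (subst sum.shift_bounds_cl_Suc_ivl[symmetric]) simp
  also have "\<dots> = (\<Sum>i=1..n-1. u i * (pad \<alpha> i - pad \<alpha> (Suc i)))"
  proof (rule sum.cong)
    fix i assume i: "i \<in> {1..n-1}"
    then have "pad \<beta> (Suc i) = \<alpha> i - \<alpha> n" "pad \<beta> (Suc (Suc i)) = \<alpha> (Suc i) - \<alpha> n"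
      using b[of i] b[of "Suc i"] by auto
    moreover have "pad \<alpha> i = \<alpha> i" "pad \<alpha> (Suc i) = \<alpha> (Suc i)" using i by (auto simp: pad_def)
    ultimately show "bisect d u (Suc i) * (pad \<beta> (Suc i) - pad \<beta> (Suc (Suc i)))
        = u i * (pad \<alpha> i - pad \<alpha> (Suc i))"
      using i by (simp add: bisect_def)
  qed simp
  finally have L: "affine_val (bisect d u) \<beta> = bisect d u 0 * (1 - \<beta> 1)
      + bisect d u 1 * (\<beta> 1 - (\<alpha> 1 - \<alpha> n)) + (\<Sum>i=1..n-1. u i * (pad \<alpha> i - pad \<alpha> (Suc i)))"
    using b[of 1] n by (simp add: affine_val_def numeral_2_eq_2)
  have "(\<Sum>i=1..n. u i * (pad \<alpha> i - pad \<alpha> (Suc i)))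
      = (\<Sum>i=1..n-1. u i * (pad \<alpha> i - pad \<alpha> (Suc i))) + u n * \<alpha> n"
    using n sum.cl_ivl_Suc[of "\<lambda>i. u i * (pad \<alpha> i - pad \<alpha> (Suc i))" 1 "n - 1"]
    by (simp add: pad_def)
  then have "affine_val u \<alpha> = u 0 * (1 - \<alpha> 1)
      + (\<Sum>i=1..n-1. u i * (pad \<alpha> i - pad \<alpha> (Suc i))) + u n * \<alpha> n"
    by (simp add: affine_val_def)
  with L show ?thesis unfolding \<beta>_def[symmetric] b1
    by (cases "d = 0") (simp_all add: bisect_def field_simps)
qed

lemma affine_val_const: "affine_val (\<lambda>_. c) \<alpha> = c"
proof -
  have "(\<Sum>i=1..n. pad \<alpha> i - pad \<alpha> (Suc i)) = pad \<alpha> 1 - pad \<alpha> (Suc n)"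
    using sum_Suc_diff[of 1 n "\<lambda>i. - pad \<alpha> i"] n by simp
  then have "affine_val (\<lambda>_. c) \<alpha> = c * (1 - \<alpha> 1) + c * (pad \<alpha> 1 - pad \<alpha> (Suc n))"
    by (simp only: affine_val_def sum_distrib_left[symmetric])
  then show ?thesis using n by (simp add: pad_def algebra_simps)
qed

lemma affine_val_mono:
  assumes \<alpha>: "\<alpha> \<in> Gam n" and uv: "\<And>i. i \<le> n \<Longrightarrow> u i \<le> v i"
  shows "affine_val u \<alpha> \<le> affine_val v \<alpha>"
proof -
  have "pad \<alpha> (Suc i) \<le> pad \<alpha> i" if "i \<in> {1..n}" for i
    using \<alpha> that by (cases "i = n") (auto simp: pad_def Gam_def)
  then show ?thesis unfolding affine_val_def
    using \<alpha> uv by (intro add_mono sum_mono mult_right_mono) (auto simp: Gam_def)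
qed

text \<open>Equal digits subject every affine function to the same bisections for \<open>x\<close>
  and \<open>y\<close>. Its vertex values merge in the limit, so no affine function separates the
  two points.\<close>

lemma symbolic_orbit_inj:
  assumes x: "x \<in> Gam n" and y: "y \<in> Gam n"
    and xa: "symbolic_orbit n x a" and ya: "symbolic_orbit n y a"
  shows "x = y"
proof -
  have Gt: "(tent n ^^ t) z \<in> Gam n" if "z \<in> Gam n" for z t
    by (induction t) (use that tent_in_Gam[OF n] in auto)
  have "affine_val u x = affine_val u y" for u
  proof -
    define V where "V t = rec_nat u (\<lambda>t w. bisect (a t) w) t" for t
    have V0: "V 0 = u" and VS: "V (Suc t) = bisect (a t) (V t)" for t by (simp_all add: V_def)
    have val: "affine_val u z = affine_val (V t) ((tent n ^^ t) z)"
      if "symbolic_orbit n z a" for z t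
    proof (induction t)
      case (Suc t)
      have "(tent n ^^ t) z \<in> tent_dom n (a t)"
        using that by (simp add: symbolic_orbit_def Gam_digit_eq[OF n])
      then show ?case using Suc affine_val_bisect by (simp add: VS)
    qed (simp add: V0)
    \<comment> \<open>\<open>Z (t + n - i)\<close> is the value at the vertex \<open>i \<ge> 1\<close> after \<open>t\<close> bisections.\<close>
    define H where "H t = V t 0" for t
    define Z where "Z s = (if s < n then u (n - s) else V (Suc (s - n)) 1)" for s
    have VZ: "V t i = Z (t + n - i)" if "1 \<le> i" "i \<le> n" for t i
      using that
    proof (induction t arbitrary: i)
      case 0
      then show ?case by (simp add: V0 Z_def)
    next
      case (Suc t)
      show ?case
      proof (cases "i = 1")
        case True
        then show ?thesis using Suc.prems by (simp add: Z_def)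
      next
        case False
        then have "V (Suc t) i = V t (i - 1)" using Suc.prems by (simp add: VS bisect_def)
        also have "\<dots> = Z (t + n - (i - 1))" using Suc False by auto
        finally show ?thesis using Suc.prems by (simp add: Suc_diff_le)
      qed
    qed
    interpret hub_queue n H Z
    proof
      fix t
      have Zt: "Z t = V t n" using VZ[of n t] n by simp
      show "Z (t + n) = (H t + Z t) / 2" unfolding Zt
        by (simp add: Z_def VS bisect_def H_def)
      show "H (Suc t) \<in> {H t, Z t}" unfolding Zt by (simp add: H_def VS bisect_def)
    qed (rule n)
    have "\<bar>affine_val u x - affine_val u y\<bar> \<le> \<epsilon>" if "\<epsilon> > 0" for \<epsilon>
    proof -
      obtain t where t: "\<And>x y. x \<in> state t \<Longrightarrow> y \<in> state t \<Longrightarrow> \<bar>x - y\<bar> \<le> \<epsilon>"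
        using state_diam_tendsto_0[OF \<open>\<epsilon> > 0\<close>] by blast
      obtain m where m: "\<And>s. s \<ge> t \<Longrightarrow> H s \<in> {m..m + \<epsilon>} \<and> Z s \<in> {m..m + \<epsilon>}"
        using state_diam_later[OF t] by blast
      have Vm: "V t i \<in> {m..m + \<epsilon>}" if "i \<le> n" for i
        using VZ[of i t] m[of t] m[of "t + n - i"] that by (cases "i = 0") (auto simp: H_def)
      have "affine_val (V t) w \<in> {m..m + \<epsilon>}" if "w \<in> Gam n" for w
        using affine_val_mono[OF that, of "\<lambda>_. m" "V t"]
          affine_val_mono[OF that, of "V t" "\<lambda>_. m + \<epsilon>"] Vm by (auto simp: affine_val_const)
      from this[OF Gt[OF x, of t]] this[OF Gt[OF y, of t]] show ?thesis
        using val[OF xa, of t] val[OF ya, of t] by auto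
    qed
    then show ?thesis by (metis dense_ge abs_le_zero_iff eq_iff_diff_eq_0)
  qed
  note eq = this
  \<comment> \<open>Coordinates are affine: the \<open>i\<close>-th one is 1 at the vertices from
    \<open>i\<close> on and 0 at the others.\<close>
  have coord: "affine_val (\<lambda>j. if i \<le> j then 1 else 0) z = z i" if "i \<in> {1..n}" for i z
  proof -
    have "(\<Sum>j=1..n. (if i \<le> j then 1 else 0) * (pad z j - pad z (Suc j)))
        = (\<Sum>j=i..n. pad z j - pad z (Suc j))"
      using that by (intro sum.mono_neutral_cong_right) auto
    also have "\<dots> = z i"
      using sum_Suc_diff[of i n "\<lambda>j. - pad z j"] that by (simp add: pad_def)
    finally show ?thesis using that by (simp add: affine_val_def)
  qed
  show ?thesis
  proof (rule extensionalityI)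
    show "x \<in> extensional {1..n}" "y \<in> extensional {1..n}" using x y by (auto simp: Gam_def)
    fix i assume "i \<in> {1..n}"
    then show "x i = y i" using coord[of i x] coord[of i y] eq by metis
  qed
qed

section \<open>The inverse branches and the final orbit of \<open>K p\<close>\<close>

lemma tau_mem: "\<beta> \<in> Gam n \<Longrightarrow> tau n d \<beta> \<in> tent_dom n d"
  using bij_betw_the_inv_into[OF bij_betw_tent[OF n, of d]] by (auto simp: tau_def bij_betw_def)

lemma tau_in_Gam: "\<beta> \<in> Gam n \<Longrightarrow> tau n d \<beta> \<in> Gam n"
  using tau_mem by (auto simp: tent_dom_def)

lemma tent_tau: "\<beta> \<in> Gam n \<Longrightarrow> tent n (tau n d \<beta>) = \<beta>"
  using bij_betw_tent[OF n, of d] f_the_inv_into_f by (fastforce simp: tau_def bij_betw_def)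

lemma tau_tent: "\<alpha> \<in> tent_dom n d \<Longrightarrow> tau n d (tent n \<alpha>) = \<alpha>"
  using bij_betw_tent[OF n, of d] by (simp add: tau_def bij_betw_def the_inv_into_f_f)

lemma tent_first: "\<alpha> 1 + \<alpha> n \<le> 1 \<Longrightarrow> tent n \<alpha> 1 = \<alpha> 1 + \<alpha> n"
  using n by (simp add: tent_def)

lemma tau_0_sum: "\<beta> \<in> Gam n \<Longrightarrow> tau n 0 \<beta> 1 + tau n 0 \<beta> n = \<beta> 1"
  using tent_first[of "tau n 0 \<beta>"] tau_mem[of \<beta> 0] tent_tau[of \<beta> 0] by (simp add: tent_dom_def)

lemma tau_1_sum: "\<beta> \<in> Gam n \<Longrightarrow> tau n 1 \<beta> 1 + tau n 1 \<beta> n \<ge> 1"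
  using tau_mem[of \<beta> 1] by (simp add: tent_dom_def)

text \<open>The face with first coordinate 1 is the image of the common boundary of the two
  domains.\<close>

lemma tau_0_eq_tau_1:
  assumes "\<beta> \<in> Gam n" "\<beta> 1 = 1"
  shows "tau n 0 \<beta> = tau n 1 \<beta>"
proof -
  have "tau n 0 \<beta> \<in> tent_dom n 1"
    using tau_0_sum[OF assms(1)] assms tau_in_Gam by (auto simp: tent_dom_def)
  from tau_tent[OF this] show ?thesis by (simp add: tent_tau assms)
qed

lemma first_eq_1_if_tau_0:
  assumes "\<beta> \<in> Gam n" "tau n 0 \<beta> 1 = 1"
  shows "\<beta> 1 = 1"
  using tau_0_sum[OF assms(1)] tau_in_Gam[OF assms(1), of 0] assms by (auto simp: Gam_def)

lemma tent_pow_in_Gam: "p \<in> Gam n \<Longrightarrow> (tent n ^^ t) p \<in> Gam n"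
  by (induction t) (auto intro: tent_in_Gam[OF n])

lemma tau_pow_in_Gam: "\<beta> \<in> Gam n \<Longrightarrow> (tau n d ^^ k) \<beta> \<in> Gam n"
  by (induction k) (auto intro: tau_in_Gam)

lemma tent_pow_tau_pow:
  assumes "\<beta> \<in> Gam n"
  shows "j \<le> k \<Longrightarrow> (tent n ^^ j) ((tau n d ^^ k) \<beta>) = (tau n d ^^ (k - j)) \<beta>"
proof (induction j)
  case (Suc j)
  then have "k - j = Suc (k - Suc j)" by simp
  with Suc show ?case by (simp add: tent_tau tau_pow_in_Gam assms)
qed simp

lemma tau_pow_tent_pow:
  "(\<And>j. j < k \<Longrightarrow> (tent n ^^ j) p \<in> tent_dom n d) \<Longrightarrow> (tau n d ^^ k) ((tent n ^^ k) p) = p"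
proof (induction k)
  case (Suc k)
  have "(tau n d ^^ Suc k) ((tent n ^^ Suc k) p)
      = (tau n d ^^ k) (tau n d (tent n ((tent n ^^ k) p)))"
    by (simp add: funpow_swap1)
  then show ?case using Suc by (simp add: tau_tent)
qed simp

lemma symbolic_orbit_tent_pow:
  "symbolic_orbit n p a \<Longrightarrow> symbolic_orbit n ((tent n ^^ k) p) (\<lambda>t. a (t + k))"
  unfolding symbolic_orbit_def by (metis comp_apply funpow_add)

section \<open>The fixed point of \<open>tau n 1\<close> and the evaluation of
  \<open>K_map\<close>\<close>

lemma v_minus_one_unique:
  assumes v: "v \<in> Gam n" "symbolic_orbit n v (\<lambda>_. 1)"
  shows "v = v_minus_one n"
proof -
  have dom: "v \<in> tent_dom n 1"
    using v(2) unfolding symbolic_orbit_def Gam_digit_eq[OF n] by (metis funpow_0)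
  \<comment> \<open>Shifting a constant sequence changes nothing, so \<open>v\<close> and its image
    share a symbolic orbit.\<close>
  have "tent n v = v"
    using symbolic_orbit_inj[OF tent_in_Gam[OF n v(1)] v(1) _ v(2)]
      symbolic_orbit_tent_pow[OF v(2), of 1] by simp
  then have fixed: "tau n 1 v = v" using tau_tent[OF dom] by simp
  have "w = v" if w: "w \<in> Gam n" "tau n 1 w = w" for w
  proof -
    have "tent n w = w" using tent_tau[OF w(1), of 1] w(2) by simp
    then have "(tent n ^^ t) w = w" for t by (induction t) auto
    moreover have "w \<in> tent_dom n 1" using tau_mem[OF w(1), of 1] w(2) by simp
    ultimately have "symbolic_orbit n w (\<lambda>_. 1)"
      by (simp add: symbolic_orbit_def Gam_digit_eq[OF n])
    then show ?thesis using symbolic_orbit_inj[OF w(1) v(1) _ v(2)] by simp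
  qed
  then show ?thesis
    unfolding v_minus_one_def using v(1) fixed by (metis (mono_tags, lifting) the_equality)
qed

lemma v_minus_one_orbit: "symbolic_orbit n (v_minus_one n) (\<lambda>_. 1)"
proof -
  \<comment> \<open>A fixed point has \<open>v i = (n + 1 - i) * C\<close> with
    \<open>C = v n\<close>; the first coordinate then requires
    \<open>(2 * n + 1) * C = 2\<close>.\<close>
  define C :: real where "C = 2 / (2 * real n + 1)"
  have "C * (2 * real n + 1) = 2" unfolding C_def by (rule nonzero_eq_divide_eq[THEN iffD1]) simp_all
  then have C: "2 * (real n * C) + C = 2" "C > 0" by (simp add: algebra_simps) (simp add: C_def)
  define v where "v = (\<lambda>i\<in>{1..n}. (real n + 1 - real i) * C)"
  have v: "v i = (real n + 1 - real i) * C" if "1 \<le> i" "i \<le> n" for i using that by (simp add: v_def)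
  have "v 1 \<le> 1" using C n by (simp add: v)
  then have G: "v \<in> Gam n" using n C by (auto simp: Gam_def v mult_right_mono) (simp add: v_def)
  have s: "v 1 + v n > 1" using C n by (simp add: v algebra_simps)
  have "tent n v = v"
  proof (rule extensionalityI)
    show "tent n v \<in> extensional {1..n}" "v \<in> extensional {1..n}"
      by (auto simp: tent_def v_def)
    fix i assume i: "i \<in> {1..n}"
    show "tent n v i = v i"
      using i s n C by (cases "i = 1") (auto simp: tent_def v of_nat_diff algebra_simps)
  qed
  then have "(tent n ^^ t) v = v" for t by (induction t) auto
  then have "symbolic_orbit n v (\<lambda>_. 1)"
    using G s by (simp add: symbolic_orbit_def Gam_digit_eq[OF n] tent_dom_def)
  with v_minus_one_unique[OF G this] show ?thesis by simp
qed

text \<open>The index \<open>k\<close> is recovered as the first time the orbit leaves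
  \<open>tent_dom n 1\<close>, and \<open>k + 1\<close> steps of \<open>tent\<close> recover
  \<open>q\<close>; this settles both choices in the definition of \<open>K_map\<close>.\<close>

lemma K_map_eq:
  assumes q: "q \<in> Gam_o n"
  shows "K_map n (tau_1k0 n k q) = (tau n 0 ^^ k) (tau n 1 q)"
proof -
  have digits: "(tent n ^^ k) (tau_1k0 n k q) \<notin> tent_dom n 1"
    "j < k \<Longrightarrow> (tent n ^^ j) (tau_1k0 n k q) \<in> tent_dom n 1"
    "(tent n ^^ Suc k) (tau_1k0 n k q) = q" if "q \<in> Gam_o n" for q j k
  proof -
    have q: "q \<in> Gam n" "q 1 < 1" "tau n 0 q \<in> Gam n" using that tau_in_Gam by (auto simp: Gam_o_def)
    note [simp] = tent_pow_tau_pow[OF q(3)]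
    show "(tent n ^^ k) (tau_1k0 n k q) \<notin> tent_dom n 1"
      using tau_0_sum[OF q(1)] q(2) by (simp add: tau_1k0_def tent_dom_def)
    show "(tent n ^^ Suc k) (tau_1k0 n k q) = q"
      by (simp add: tau_1k0_def tent_tau q(1))
    assume "j < k"
    then have "k - j = Suc (k - Suc j)" by simp
    then show "(tent n ^^ j) (tau_1k0 n k q) \<in> tent_dom n 1"
      using \<open>j < k\<close> tau_mem[OF tau_pow_in_Gam[OF q(3)]] by (simp add: tau_1k0_def)
  qed
  let ?p = "tau_1k0 n k q"
  have "?p \<noteq> v_minus_one n"
    using digits(1)[OF q, of k] v_minus_one_orbit
    by (auto simp: symbolic_orbit_def Gam_digit_eq[OF n])
  moreover have "(THE j. ?p \<in> tau_1k0 n j ` Gam_o n) = k"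
  proof (rule the_equality)
    fix j assume "?p \<in> tau_1k0 n j ` Gam_o n"
    then obtain q' where "q' \<in> Gam_o n" "?p = tau_1k0 n j q'" by blast
    then show "j = k" using digits(1,2)[OF q] digits(1,2)[of q'] by (metis linorder_neqE_nat)
  qed (use q in blast)
  moreover have "the_inv_into (Gam_o n) (tau_1k0 n k) ?p = q"
    using q digits(3) by (intro the_inv_into_f_f inj_onI) metis+
  ultimately show ?thesis by (simp add: K_map_def)
qed

text \<open>\<open>L\<close> is the first index below \<open>k\<close> where the first coordinate is
  not 1, or \<open>k\<close> itself. Once lost, the value 1 never returns; before that,
  \<open>tau n 0\<close> acts as \<open>tau n 1\<close>.\<close>

lemma tau_0_pow_tau_1_first:
  assumes q: "q \<in> Gam n"
  obtains L where "L \<le> k"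
    "\<And>i. i < k \<Longrightarrow> ((tau n 0 ^^ i) (tau n 1 q)) 1 = 1 \<longleftrightarrow> i < L"
    "\<And>i. i \<le> L \<Longrightarrow> (tau n 0 ^^ i) (tau n 1 q) = (tau n 1 ^^ Suc i) q"
proof -
  define x where "x i = (tau n 0 ^^ i) (tau n 1 q)" for i
  have xG: "x i \<in> Gam n" for i by (simp add: x_def tau_pow_in_Gam tau_in_Gam q)
  define L where "L = (LEAST i. i = k \<or> x i 1 \<noteq> 1)"
  have L: "L = k \<or> x L 1 \<noteq> 1" unfolding L_def by (rule LeastI[of _ k]) simp
  have L_le: "L \<le> k" unfolding L_def by (rule Least_le) simp
  have less: "x i 1 = 1" if "i < L" for i using not_less_Least[of i] that unfolding L_def by blast
  have ge: "x (L + d) 1 \<noteq> 1" if "L < k" for d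
    using L that first_eq_1_if_tau_0[OF xG] by (induction d) (auto simp: x_def)
  have eq: "x i = (tau n 1 ^^ Suc i) q" if "i \<le> L" for i
    using that
  proof (induction i)
    case (Suc i)
    have "x (Suc i) = tau n 0 (x i)" by (simp add: x_def)
    also have "\<dots> = tau n 1 (x i)" using tau_0_eq_tau_1 xG less Suc.prems by simp
    finally show ?case using Suc by simp
  qed (simp add: x_def)
  show thesis
  proof (rule that[OF L_le])
    fix i assume "i < k"
    then show "(tau n 0 ^^ i) (tau n 1 q) 1 = 1 \<longleftrightarrow> i < L"
      using less[of i] ge[of "i - L"] by (cases "i < L") (auto simp: x_def)
  qed (use eq x_def in auto)
qed

lemma final_orbit_of_tau:
  assumes q: "q \<in> Gam n" and b: "final_orbit_of n q b" and L: "L \<le> k"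
    and first: "\<And>i. i < k \<Longrightarrow> ((tau n 0 ^^ i) (tau n 1 q)) 1 = 1 \<longleftrightarrow> i < L"
  shows "final_orbit_of n ((tau n 0 ^^ k) (tau n 1 q))
    (\<lambda>t. if t < k - L then 0 else if t \<le> k then 1 else b (t - Suc k))"
    (is "final_orbit_of n ?r ?c")
proof -
  have y: "tau n 1 q \<in> Gam n" by (simp add: tau_in_Gam q)
  have "?c t = (if (tent n ^^ t) ?r 1 + (tent n ^^ t) ?r n \<ge> 1 then 1 else 0)" for t
  proof (cases t k rule: linorder_cases)
    case less
    \<comment> \<open>Time reverses the index: those below \<open>L\<close> are the times from
      \<open>k - L\<close> to \<open>k - 1\<close>.\<close>
    let ?x = "(tau n 0 ^^ (k - Suc t)) (tau n 1 q)"
    have x: "?x \<in> Gam n" by (rule tau_pow_in_Gam[OF y])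
    have "k - t = Suc (k - Suc t)" using less by simp
    then have "(tent n ^^ t) ?r = tau n 0 ?x" using less
      by (simp add: tent_pow_tau_pow[OF y] del: One_nat_def)
    then have "(tent n ^^ t) ?r 1 + (tent n ^^ t) ?r n = ?x 1" using tau_0_sum[OF x] by simp
    moreover have "?x 1 \<ge> 1 \<longleftrightarrow> ?x 1 = 1" using x by (auto simp: Gam_def)
    ultimately show ?thesis using first[of "k - Suc t"] less L by auto
  next
    case equal
    then show ?thesis using tau_1_sum[OF q] by (simp add: tent_pow_tau_pow[OF y] del: One_nat_def)
  next
    case greater
    then have t: "t = (t - Suc k) + Suc k" by simp
    have "(tent n ^^ Suc k) ?r = q" by (simp add: tent_pow_tau_pow[OF y] tent_tau[OF q] del: One_nat_def)
    then have "(tent n ^^ t) ?r = (tent n ^^ (t - Suc k)) q"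
      by (subst t) (simp only: funpow_add comp_apply)
    moreover have "\<not> t < k - L" "\<not> t \<le> k" using greater by auto
    ultimately show ?thesis using b unfolding final_orbit_of_iff[OF n q] by simp
  qed
  then show ?thesis by (subst final_orbit_of_iff[OF n]) (simp_all add: tau_pow_in_Gam y del: One_nat_def)
qed

text \<open>Going backwards from time \<open>k\<close>: a point whose image has first coordinate 1
  has final digit 1 and is \<open>tau n 1\<close> of that image. This constrains every competing
  final orbit.\<close>

lemma final_orbit_forced_ones:
  assumes p: "p \<in> Gam n" and c: "final_orbit_of n p c" and q: "(tent n ^^ Suc k) p = q"
    and ck: "c k = 1" and L: "L \<le> k"
    and first: "\<And>i. i < L \<Longrightarrow> ((tau n 1 ^^ Suc i) q) 1 = 1"
  shows "l \<le> L \<Longrightarrow> c (k - l) = 1 \<and> (tent n ^^ (k - l)) p = (tau n 1 ^^ Suc l) q"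
proof (induction l)
  case 0
  have "(tent n ^^ k) p \<in> tent_dom n 1"
    using c ck unfolding final_orbit_of_def symbolic_orbit_def Gam_digit_eq[OF n] by metis
  then show ?case using ck q tau_tent by fastforce
next
  case (Suc l)
  let ?w = "(tent n ^^ (k - Suc l)) p"
  have "k - l = Suc (k - Suc l)" using Suc.prems L by simp
  then have w: "tent n ?w = (tau n 1 ^^ Suc l) q" using Suc by simp
  then have "tent n ?w 1 = 1" using first[of l] Suc.prems by simp
  then have ge: "?w 1 + ?w n \<ge> 1" using tent_first[of ?w] by fastforce
  then have "?w \<in> tent_dom n 1" using tent_pow_in_Gam[OF p] by (simp add: tent_dom_def)
  from tau_tent[OF this] have "?w = (tau n 1 ^^ Suc (Suc l)) q" by (simp add: w)
  then show ?case using ge c unfolding final_orbit_of_iff[OF n p] by simp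
qed

end

section \<open>Adding a natural number to a 2-adic integer\<close>

text \<open>The carry into position \<open>i\<close> is the overflow from adding both truncations to
  \<open>i\<close> digits.\<close>

lemma carry_adic_of_nat:
  assumes a: "\<And>i. a i \<le> 1"
  shows "carry a (adic_of_nat r) i = ((\<Sum>j<i. a j * 2 ^ j) + r mod 2 ^ i) div 2 ^ i"
proof (induction i)
  case (Suc i)
  define N where "N = (\<Sum>j<i. a j * 2 ^ j)"
  have "N + a i * 2 ^ i + r mod 2 ^ Suc i
      = N + r mod 2 ^ i + (a i + r div 2 ^ i mod 2) * 2 ^ i"
    using mod_mult2_eq[of r "2 ^ i" 2] by (simp add: algebra_simps)
  then have "(N + a i * 2 ^ i + r mod 2 ^ Suc i) div 2 ^ i
      = a i + r div 2 ^ i mod 2 + (N + r mod 2 ^ i) div 2 ^ i"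
    by (simp only:) simp
  then show ?case using Suc
    by (simp add: N_def adic_of_nat_def div_mult2_eq mult.commute[of 2])
qed simp

lemma adic_add_of_nat:
  assumes a: "\<And>i. a i \<le> 1"
  shows "adic_add a (adic_of_nat r) i = ((\<Sum>j<Suc i. a j * 2 ^ j) + r) div 2 ^ i mod 2"
proof -
  define N where "N = (\<Sum>j<i. a j * 2 ^ j)"
  have "N + a i * 2 ^ i + r = (N + r mod 2 ^ i) + (a i + r div 2 ^ i) * 2 ^ i"
    by (simp add: algebra_simps)
  then have "(N + a i * 2 ^ i + r) div 2 ^ i = a i + r div 2 ^ i + (N + r mod 2 ^ i) div 2 ^ i"
    by (simp only:) simp
  moreover have "(x + y mod 2 + z) mod 2 = (x + y + z) mod 2" for x y z :: nat
    by (metis mod_add_left_eq mod_add_right_eq)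
  ultimately show ?thesis
    by (simp only: adic_add_def carry_adic_of_nat[OF a] adic_of_nat_def N_def sum.lessThan_Suc)
qed

lemma adic_add_ones: "adic_add (\<lambda>_. 1) (adic_of_nat 1) = (\<lambda>_. 0)"
proof
  fix i
  have "(\<Sum>j<Suc i. 1 * 2 ^ j) + 1 = (2 ^ Suc i :: nat)" by (induction i) auto
  then have "((\<Sum>j<Suc i. 1 * 2 ^ j) + 1) div 2 ^ i mod 2 = (0 :: nat)" by (simp only:) simp
  then show "adic_add (\<lambda>_. 1) (adic_of_nat 1) i = 0"
    using adic_add_of_nat[of "\<lambda>_. 1" 1 i, OF order_refl] by (simp only:)
qed

text \<open>The leading block of \<open>a\<close> has value \<open>2 ^ k - 1\<close>, so the
  addition turns it into \<open>m\<close>, which still fits into \<open>k + 1\<close> digits: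
  nothing is carried into the tail.\<close>

lemma adic_add_ones_zero:
  assumes a: "\<And>i. a i \<le> 1" and ones: "\<And>i. i < k \<Longrightarrow> a i = 1" and zero: "a k = 0"
    and m: "2 ^ k \<le> m" "m < 2 ^ Suc k"
  shows "adic_add a (adic_of_nat (m + 1 - 2 ^ k)) = (\<lambda>i. if i \<le> k then m div 2 ^ i mod 2 else a i)"
proof
  fix i
  define N where "N i = (\<Sum>j<i. a j * 2 ^ j)" for i
  have geo: "(\<Sum>j<i. 2 ^ j) + 1 = (2 ^ i :: nat)" for i by (induction i) auto
  have low: "N i + 1 = 2 ^ i" if "i \<le> k" for i
    using that ones geo[of i] by (simp add: N_def)
  have NS: "N (Suc i) = N i + a i * 2 ^ i" for i by (simp add: N_def)
  define r where "r = m + 1 - 2 ^ k"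
  have r: "r + 2 ^ k = m + 1" using m by (simp add: r_def)
  have "(N (Suc i) + r) div 2 ^ i mod 2 = (if i \<le> k then m div 2 ^ i mod 2 else a i)"
  proof (cases i k rule: linorder_cases)
    case less
    then have "N (Suc i) + 1 = 2 ^ Suc i" using low[of "Suc i"] by simp
    \<comment> \<open>The terms \<open>2 ^ k\<close> and \<open>2 ^ Suc i\<close> are even multiples
      of \<open>2 ^ i\<close>, so neither affects digit \<open>i\<close>.\<close>
    then have "N (Suc i) + r + 2 ^ k = m + 2 ^ Suc i" using r by simp
    moreover obtain d where "k = Suc i + d" using less by (metis less_iff_Suc_add add_Suc)
    then have "(2::nat) ^ k = 2 * 2 ^ d * 2 ^ i" by (simp add: power_add)
    ultimately have "N (Suc i) + r + (2 * 2 ^ d) * 2 ^ i = m + 2 * 2 ^ i" by simp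
    then have "(N (Suc i) + r + (2 * 2 ^ d) * 2 ^ i) div 2 ^ i = (m + 2 * 2 ^ i) div 2 ^ i" by simp
    then have "(N (Suc i) + r) div 2 ^ i + 2 * 2 ^ d = m div 2 ^ i + 2" by simp
    then have "((N (Suc i) + r) div 2 ^ i + 2 * 2 ^ d) mod 2 = (m div 2 ^ i + 2) mod 2" by simp
    then show ?thesis using less by simp
  next
    case equal
    then have "N (Suc i) + r = m" using NS[of k] low[of k] zero r by simp
    then show ?thesis using equal by simp
  next
    case greater
    have "N (Suc k + d) + r < 2 ^ (Suc k + d)" for d
    proof (induction d)
      case 0
      have "N (Suc k) + 1 = 2 ^ k" using NS[of k] low[of k] zero by simp
      then show ?case using r m(2) by simp
    next
      case (Suc d)
      have "a (Suc k + d) * 2 ^ (Suc k + d) \<le> 2 ^ (Suc k + d)" using a[of "Suc k + d"] by simp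
      then show ?case using Suc NS[of "Suc k + d"]
        by (simp only: add_Suc_right power_Suc)
    qed
    from this[of "i - Suc k"] have "N i + r < 2 ^ i" using greater by simp
    moreover have "N (Suc i) + r = (N i + r) + a i * 2 ^ i" by (simp add: NS)
    ultimately have "(N (Suc i) + r) div 2 ^ i = a i" by (simp only:) simp
    then show ?thesis using greater a[of i] by auto
  qed
  then show "adic_add a (adic_of_nat (m + 1 - 2 ^ k)) i
      = (if i \<le> k then m div 2 ^ i mod 2 else a i)"
    by (simp only: adic_add_of_nat[OF a] N_def r_def)
qed

lemma bits_of_ones_block:
  assumes L: "L \<le> k" and i: "i \<le> k"
  shows "(2 ^ Suc k - 2 ^ (k - L)) div 2 ^ i mod 2 = (if i < k - L then 0 else 1 :: nat)"
proof (cases "i < k - L")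
  case True
  then obtain d e where "Suc k = Suc i + d" "k - L = Suc i + e"
    by (metis add_Suc i le_Suc_ex less_iff_Suc_add)
  then have "(2 ^ Suc k - 2 ^ (k - L) :: nat) = 2 ^ i * (2 * (2 ^ d - 2 ^ e))"
    by (simp only: power_add power_Suc diff_mult_distrib2 mult_ac)
  then show ?thesis using True by simp
next
  case False
  define l where "l = Suc k - i"
  have l: "Suc k = i + l" "l \<ge> 1" using i by (auto simp: l_def)
  obtain e where e: "i = (k - L) + e" using False by (metis le_Suc_ex not_less)
  have "(2::nat) ^ (k - L) \<le> 2 ^ i" using e by simp
  then have lt: "2 ^ i - 2 ^ (k - L) < (2 ^ i :: nat)" by simp
  have "(2 ^ l - 1) * 2 ^ i + 2 ^ i = (2 ^ i * 2 ^ l :: nat)" by (simp add: diff_mult_distrib)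
  then have "2 ^ Suc k - 2 ^ (k - L) = (2 ^ l - 1) * 2 ^ i + (2 ^ i - 2 ^ (k - L) :: nat)"
    using Nat.add_diff_assoc[OF \<open>2 ^ (k - L) \<le> 2 ^ i\<close>, of "(2 ^ l - 1) * 2 ^ i"]
    unfolding l(1) power_add by (simp only:)
  then have "(2 ^ Suc k - 2 ^ (k - L)) div 2 ^ i = (2 ^ l - 1 :: nat)"
    using lt by simp
  moreover have "odd (2 ^ l - 1 :: nat)" using l(2) by simp
  ultimately show ?thesis using False by (simp only: odd_iff_mod_2_eq_one if_False)
qed

text \<open>With ones forced at positions \<open>k - L\<close> to \<open>k\<close>, the smallest
  choice has zeros below.\<close>

lemma ones_block_least:
  fixes m :: nat
  assumes L: "L \<le> k" and ones: "\<And>l. l \<le> L \<Longrightarrow> m div 2 ^ (k - l) mod 2 = 1"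
  shows "2 ^ Suc k - 2 ^ (k - L) \<le> m"
proof -
  have "2 ^ Suc l \<le> m div 2 ^ (k - l) + 1" if "l \<le> L" for l
    using that
  proof (induction l)
    case 0
    have "m div 2 ^ k \<noteq> 0" using ones[of 0] by fastforce
    then show ?case by simp
  next
    case (Suc l)
    have "k - l = Suc (k - Suc l)" using Suc.prems L by simp
    then have "m div 2 ^ (k - l) = m div 2 ^ (k - Suc l) div 2"
      by (simp only: power_Suc2 div_mult2_eq)
    then have "m div 2 ^ (k - Suc l) = 2 * (m div 2 ^ (k - l)) + 1"
      using ones[OF Suc.prems] by (metis mult_div_mod_eq)
    then show ?case using Suc by simp
  qed
  from this[OF order_refl]
  have "2 ^ Suc L * 2 ^ (k - L) \<le> (m div 2 ^ (k - L) + 1) * 2 ^ (k - L)" by (rule mult_le_mono1)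
  also have "\<dots> \<le> m + 2 ^ (k - L)" by (simp add: algebra_simps)
  also have "2 ^ Suc L * 2 ^ (k - L) = (2 ^ Suc k :: nat)"
    using L by (simp only: power_add[symmetric]) simp
  finally show ?thesis by simp
qed

section \<open>The smallest increment reaching a final orbit\<close>

theorem theorem3p5:
  fixes n :: nat and p :: "nat \<Rightarrow> real" and a :: "nat \<Rightarrow> nat"
  assumes "n \<ge> 1"
    and "p \<in> Gam n"
    and "final_orbit_of n p a"
  shows "\<exists>s::nat. s \<ge> 1 \<and> is_final_orbit n (adic_add a (adic_of_nat s)) \<and>
           (\<forall>r::nat. r \<ge> 1 \<and> is_final_orbit n (adic_add a (adic_of_nat r)) \<longrightarrow> s \<le> r) \<and>
           final_orbit_of n (K_map n p) (adic_add a (adic_of_nat s))"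
proof -
  note n = assms(1) and p = assms(2) and a = assms(3)
  have a01: "a i \<in> {0, 1}" for i
    using a unfolding final_orbit_of_def symbolic_orbit_def by blast
  have sym: "symbolic_orbit n p a" using a by (simp add: final_orbit_of_def)
  show ?thesis
  proof (cases "\<forall>i. a i = 1")
    \<comment> \<open>Here \<open>a\<close> is -1, and adding 1 gives 0, the orbit of the fixed
      point \<open>v_zero n\<close>; \<open>s = 1\<close> is trivially least.\<close>
    case True
    then have a1: "a = (\<lambda>_. 1)" by auto
    then have "p = v_minus_one n" using v_minus_one_unique[OF n p] sym by simp
    then have Kp: "K_map n p = v_zero n" by (simp add: K_map_def)
    have G: "v_zero n \<in> Gam n" using n by (auto simp: Gam_def v_zero_def)
    have "tent n (v_zero n) = v_zero n" using n by (auto simp: tent_def v_zero_def fun_eq_iff)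
    then have "(tent n ^^ t) (v_zero n) = v_zero n" for t by (induction t) auto
    then have "final_orbit_of n (v_zero n) (\<lambda>_. 0)"
      unfolding final_orbit_of_iff[OF n G] using n by (simp add: v_zero_def)
    then show ?thesis
      using G by (intro exI[of _ 1]) (auto simp: a1 adic_add_ones Kp is_final_orbit_def simp del: One_nat_def)
  next
    case False
    define k where "k = (LEAST i. a i \<noteq> 1)"
    have "a k \<noteq> 1" unfolding k_def by (rule LeastI_ex) (use False in auto)
    then have ak: "a k = 0" using a01[of k] by simp
    have ones: "a i = 1" if "i < k" for i using not_less_Least[of i] that unfolding k_def by blast
    have a_le: "a i \<le> 1" for i using a01[of i] by auto
    define q where "q = (tent n ^^ Suc k) p"
    have qG: "q \<in> Gam n" unfolding q_def by (rule tent_pow_in_Gam[OF n p])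
    have dom: "(tent n ^^ j) p \<in> tent_dom n (a j)" for j
      using sym by (simp add: symbolic_orbit_def Gam_digit_eq[OF n])
    have "(tent n ^^ k) p 1 + (tent n ^^ k) p n < 1"
      using a ak unfolding final_orbit_of_iff[OF n p] by (metis not_less zero_neq_one)
    then have "q 1 < 1" using tent_first[OF n, of "(tent n ^^ k) p"] by (simp add: q_def)
    with qG have qo: "q \<in> Gam_o n" by (simp add: Gam_o_def)
    have "tau n 0 q = (tent n ^^ k) p" using tau_tent[OF n] dom[of k] ak by (simp add: q_def)
    then have "tau_1k0 n k q = p"
      using tau_pow_tent_pow[OF n, of k p 1] dom ones by (metis comp_apply tau_1k0_def)
    then have Kp: "K_map n p = (tau n 0 ^^ k) (tau n 1 q)" using K_map_eq[OF n qo, of k] by simp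
    define b where "b t = a (t + Suc k)" for t
    have b: "final_orbit_of n q b"
      using a unfolding final_orbit_of_iff[OF n p] final_orbit_of_iff[OF n qG]
      by (simp only: b_def q_def funpow_add comp_apply simp_thms)
    obtain L where L: "L \<le> k"
      "\<And>i. i < k \<Longrightarrow> ((tau n 0 ^^ i) (tau n 1 q)) 1 = 1 \<longleftrightarrow> i < L"
      "\<And>i. i \<le> L \<Longrightarrow> (tau n 0 ^^ i) (tau n 1 q) = (tau n 1 ^^ Suc i) q"
      using tau_0_pow_tau_1_first[OF n qG, where k = k] by blast
    \<comment> \<open>\<open>M\<close> is the value of the new leading block, and \<open>s\<close>
      its excess over the old value \<open>2 ^ k - 1\<close>.\<close>
    define M :: nat where "M = 2 ^ Suc k - 2 ^ (k - L)"
    define s where "s = M + 1 - 2 ^ k"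
    have "(2::nat) ^ (k - L) \<le> 2 ^ k" "(2::nat) ^ (k - L) > 0" by simp_all
    then have M: "2 ^ k \<le> M" "M < 2 ^ Suc k" unfolding M_def power_Suc by linarith+
    have "adic_add a (adic_of_nat s) = (\<lambda>i. if i \<le> k then M div 2 ^ i mod 2 else a i)"
      unfolding s_def by (rule adic_add_ones_zero[where a = a and k = k, OF a_le ones ak M])
    also have "\<dots> = (\<lambda>t. if t < k - L then 0 else if t \<le> k then 1 else b (t - Suc k))"
      using bits_of_ones_block[OF L(1)] by (auto simp: M_def b_def fun_eq_iff)
    finally have final: "final_orbit_of n (K_map n p) (adic_add a (adic_of_nat s))"
      unfolding Kp using final_orbit_of_tau[OF n qG b L(1,2)] by simp
    have KG: "K_map n p \<in> Gam n" unfolding Kp by (intro tau_pow_in_Gam tau_in_Gam n qG)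
    have least: "s \<le> r" if r: "r \<ge> 1" and fin: "is_final_orbit n (adic_add a (adic_of_nat r))" for r
    proof (rule ccontr)
      assume "\<not> s \<le> r"
      \<comment> \<open>A smaller \<open>r\<close> also rewrites only the leading block, to
        \<open>m\<close> with top digit 1. The tail \<open>b\<close> then forces the same
        \<open>q\<close>, and the forced ones give \<open>M \<le> m\<close>.\<close>
      define m where "m = r + 2 ^ k - 1"
      have m: "2 ^ k \<le> m" "m < M" "r = m + 1 - 2 ^ k"
        using r \<open>\<not> s \<le> r\<close> by (auto simp: m_def s_def)
      then have m2: "m < 2 ^ Suc k" using M(2) by simp
      define c where "c = (\<lambda>i. if i \<le> k then m div 2 ^ i mod 2 else a i)"
      have c: "adic_add a (adic_of_nat r) = c" unfolding m(3) c_def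
        by (rule adic_add_ones_zero[where a = a and k = k, OF a_le ones ak m(1) m2])
      obtain p' where p': "p' \<in> Gam n" "final_orbit_of n p' c"
        using fin unfolding is_final_orbit_def c by blast
      have "symbolic_orbit n ((tent n ^^ Suc k) p') b"
        using symbolic_orbit_tent_pow[OF n, of p' c "Suc k"] p'(2)
        by (simp add: final_orbit_of_def b_def[abs_def] c_def)
      then have q': "(tent n ^^ Suc k) p' = q"
        using symbolic_orbit_inj[OF n tent_pow_in_Gam[OF n p'(1)] qG] b
        unfolding final_orbit_of_def by blast
      have "m div 2 ^ k = 1" using m(1) m2 by (intro div_nat_eqI) auto
      then have ck: "c k = 1" by (simp add: c_def)
      have first: "((tau n 1 ^^ Suc i) q) 1 = 1" if "i < L" for i
        using L(1) L(2)[of i] L(3)[of i] that by simp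
      have "c (k - l) = 1" if "l \<le> L" for l
        using final_orbit_forced_ones[OF n p' q' ck L(1) first that] by blast
      then have "M \<le> m" unfolding M_def using ones_block_least[OF L(1)] by (simp add: c_def)
      then show False using m(2) by simp
    qed
    have "s \<ge> 1" using M(1) by (simp add: s_def)
    then show ?thesis using final KG least by (auto simp: is_final_orbit_def)
  qed
qed

end
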